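(* Let $d,d',d'',N\in \mathbb{N}$ be such that $d=d'+d''$. Let $A \subseteq [0,1)^{d'}$ and $B \subseteq [0,1)^{d''}$ be Borel measurable sets. Let $x_1,\ldots,x_N$ be a sampling scheme in $[0,1)^{d'}$ and $y_1,\ldots,y_N$ a sampling scheme in $[0,1)^{d''}$. Furthermore, let $\alpha, \beta \geq 1$. (i) If the random variables $\mathbf{1}_A(x_i)$, $i=1,\ldots,N$, and $\mathbf{1}_B(y_i)$, $i=1,\ldots,N$, are upper $\alpha$-negatively dependent and upper $\beta$-negatively dependent, respectively, and mutually independent (the first family is independent of the second), then the random variables $\mathbf{1}_{A\times B}(x_i,y_i)$, $i=1,\ldots,N$, induced by the random vectors $(x_1,y_1),\ldots,(x_N,y_N)$ in $[0,1)^d$, are upper $\alpha\beta$-negatively dependent. (ii) If the random variables $\mathbf{1}_A(x_i)$, $i=1,\ldots,N$, and $\mathbf{1}_B(y_i)$, $i=1,\ldots,N$, are lower $\alpha$-negatively dependent and lower $\beta$-negatively dependent, respectively, and mutually independent (the first family is independent of the second), then the random variables $\mathbf{1}_{A\times B}(x_i,y_i)$, $i=1,\ldots,N$, induced by the random vectors $(x_1,y_1),\ldots,(x_N,y_N)$ in $[0,1)^d$, are lower $\alpha\beta$-negatively dependent.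
   Context: $[N]=\{1,\ldots,N\}$, $\mathbf{1}_Q$ is the indicator function of $Q$, and all random variables are defined on a probability space $(\Omega,\Sigma,\mathbf{P})$. Sampling scheme in $[0,1)^m$: a random family $(p_j)_{j=1}^N$ of points in $[0,1)^m$ such that each $p_j$ is uniformly distributed in $[0,1)^m$ and $(p_1,\ldots,p_N)$ is exchangeable, i.e. for every permutation $\pi$ of $[N]$ the law of $(p_{\pi(1)},\ldots,p_{\pi(N)})$ equals the law of $(p_1,\ldots,p_N)$. For $\gamma\ge1$, random variables $T_1,\ldots,T_N$ with values in $\{0,1\}$ are upper $\gamma$-negatively dependent if $\mathbf{P}(\bigcap_{j\in u}\{T_j=1\})\le\gamma\prod_{j\in u}\mathbf{P}(T_j=1)$ for all $u\subseteq[N]$, and lower $\gamma$-negatively dependent if $\mathbf{P}(\bigcap_{j\in u}\{T_j=0\})\le\gamma\prod_{j\in u}\mathbf{P}(T_j=0)$ for all $u\subseteq[N]$. *)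

theory Defs
  imports "HOL-Probability.Probability" "HOL-Combinatorics.Permutations"
begin

text \<open>
  The half-open cube. It is stated for an arbitrary Euclidean space so that it also covers
  \<open>real^'m \<times> real^'n\<close>, the model of \<open>d\<close>-space with \<open>d = CARD('m) + CARD('n)\<close> used for the
  concatenated points. The interval \<open>{0..<1}\<close> would be the wrong set: on \<open>real^'m\<close> the
  relation \<open>x < y\<close> means \<open>x \<le> y \<and> x \<noteq> y\<close>, not strict inequality in every coordinate.
\<close>

definition unit_cube :: "'a::euclidean_space set" where
  "unit_cube = {x. \<forall>b\<in>Basis. 0 \<le> x \<bullet> b \<and> x \<bullet> b < 1}"

lemma unit_cube_vec: "(unit_cube :: (real^'m) set) = {x. \<forall>i. 0 \<le> x $ i \<and> x $ i < 1}"
  by (auto simp: unit_cube_def Basis_vec_def inner_axis)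

lemma unit_cube_Times:
  "(unit_cube :: ('a::euclidean_space \<times> 'b::euclidean_space) set) = unit_cube \<times> unit_cube"
  by (auto simp: unit_cube_def Basis_prod_def ball_Un)

text \<open>The law of \<open>(p\<^sub>1, \<dots>, p\<^sub>N)\<close> is a measure on the product space over \<open>{1..N}\<close>.\<close>

definition sampling_scheme ::
    "'w measure \<Rightarrow> nat \<Rightarrow> (nat \<Rightarrow> 'w \<Rightarrow> 'a::euclidean_space) \<Rightarrow> bool" where
  "sampling_scheme M N p \<longleftrightarrow>
     (\<forall>j\<in>{1..N}. p j \<in> measurable M (restrict_space borel unit_cube) \<and>
                 distr M borel (p j) = uniform_measure lborel unit_cube) \<and>
     (\<forall>\<pi>. \<pi> permutes {1..N} \<longrightarrow>
        distr M (Pi\<^sub>M {1..N} (\<lambda>_. borel)) (\<lambda>\<omega>. \<lambda>j\<in>{1..N}. p (\<pi> j) \<omega>) =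
        distr M (Pi\<^sub>M {1..N} (\<lambda>_. borel)) (\<lambda>\<omega>. \<lambda>j\<in>{1..N}. p j \<omega>))"

definition zero_one_rvs :: "'w measure \<Rightarrow> nat \<Rightarrow> (nat \<Rightarrow> 'w \<Rightarrow> real) \<Rightarrow> bool" where
  "zero_one_rvs M N T \<longleftrightarrow>
     (\<forall>j\<in>{1..N}. T j \<in> borel_measurable M \<and> (\<forall>\<omega>\<in>space M. T j \<omega> \<in> {0, 1}))"

text \<open>
  The intersection over \<open>j \<in> u\<close> is written as a comprehension over \<open>space M\<close>, so that it is
  the whole space for \<open>u = {}\<close>.
\<close>

definition upper_neg_dep :: "'w measure \<Rightarrow> nat \<Rightarrow> real \<Rightarrow> (nat \<Rightarrow> 'w \<Rightarrow> real) \<Rightarrow> bool" where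
  "upper_neg_dep M N \<gamma> T \<longleftrightarrow> 1 \<le> \<gamma> \<and> zero_one_rvs M N T \<and>
     (\<forall>u\<subseteq>{1..N}. measure M {\<omega>\<in>space M. \<forall>j\<in>u. T j \<omega> = 1}
        \<le> \<gamma> * (\<Prod>j\<in>u. measure M {\<omega>\<in>space M. T j \<omega> = 1}))"

definition lower_neg_dep :: "'w measure \<Rightarrow> nat \<Rightarrow> real \<Rightarrow> (nat \<Rightarrow> 'w \<Rightarrow> real) \<Rightarrow> bool" where
  "lower_neg_dep M N \<gamma> T \<longleftrightarrow> 1 \<le> \<gamma> \<and> zero_one_rvs M N T \<and>
     (\<forall>u\<subseteq>{1..N}. measure M {\<omega>\<in>space M. \<forall>j\<in>u. T j \<omega> = 0}
        \<le> \<gamma> * (\<Prod>j\<in>u. measure M {\<omega>\<in>space M. T j \<omega> = 0}))"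

text \<open>
  Independence of the two families as a whole, i.e. of the random vectors
  \<open>(S\<^sub>1, \<dots>, S\<^sub>N)\<close> and \<open>(T\<^sub>1, \<dots>, T\<^sub>N)\<close>; nothing is required within either family.
\<close>

definition indep_families ::
    "'w measure \<Rightarrow> nat \<Rightarrow> (nat \<Rightarrow> 'w \<Rightarrow> real) \<Rightarrow> (nat \<Rightarrow> 'w \<Rightarrow> real) \<Rightarrow> bool" where
  "indep_families M N S T \<longleftrightarrow>
     prob_space.indep_var M
       (Pi\<^sub>M {1..N} (\<lambda>_. borel)) (\<lambda>\<omega>. \<lambda>i\<in>{1..N}. S i \<omega>)
       (Pi\<^sub>M {1..N} (\<lambda>_. borel)) (\<lambda>\<omega>. \<lambda>i\<in>{1..N}. T i \<omega>)"

end

theory Submission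
  imports Defs
begin

text \<open>
  With \<open>S\<^sub>i = 1\<^sub>A(x\<^sub>i)\<close> and \<open>T\<^sub>i = 1\<^sub>B(y\<^sub>i)\<close> the induced variables are the products \<open>S\<^sub>i T\<^sub>i\<close>.
  Part (i) is then immediate from independence. For part (ii), put \<open>a\<^sub>j = P(S\<^sub>j = 1)\<close>,
  \<open>b\<^sub>j = P(T\<^sub>j = 1)\<close>. Conditioning on the random set \<open>V = {j \<in> u. T\<^sub>j = 1}\<close>, the event that all
  products vanish has conditional probability at most \<open>\<alpha> \<Prod>\<^sub>j\<^sub>\<in>\<^sub>V (1 - a\<^sub>j)\<close>. This product equals
  \<open>\<Prod>\<^sub>j\<^sub>\<in>\<^sub>u ((1 - a\<^sub>j) + a\<^sub>j 1{T\<^sub>j = 0})\<close>, whose expansion has nonnegative coefficients, so lower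
  negative dependence of the \<open>T\<^sub>j\<close> bounds its expectation by
  \<open>\<beta> \<Prod>\<^sub>j\<^sub>\<in>\<^sub>u ((1 - a\<^sub>j) + a\<^sub>j (1 - b\<^sub>j)) = \<beta> \<Prod>\<^sub>j\<^sub>\<in>\<^sub>u (1 - a\<^sub>j b\<^sub>j)\<close>.
\<close>

text \<open>Independence is assumed only for the two full vectors, so each coordinatewise condition
  must be realised as a measurable box. The index sets are separate and the target sets may vary
  with \<open>j\<close>, because the lower case constrains \<open>S\<close> on a subset of
  \<open>u\<close> and prescribes a whole zero-one pattern for \<open>T\<close> on
  \<open>u\<close>.\<close>

lemma indep_families_prob:
  assumes "prob_space M" and "indep_families M N S T"
    and V: "V \<subseteq> {1..N}" and W: "W \<subseteq> {1..N}"
    and P: "\<And>j. P j \<in> sets borel" and Q: "\<And>j. Q j \<in> sets borel"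
  shows "measure M {\<omega>\<in>space M. (\<forall>j\<in>V. S j \<omega> \<in> P j) \<and> (\<forall>j\<in>W. T j \<omega> \<in> Q j)} =
    measure M {\<omega>\<in>space M. \<forall>j\<in>V. S j \<omega> \<in> P j} * measure M {\<omega>\<in>space M. \<forall>j\<in>W. T j \<omega> \<in> Q j}"
proof -
  interpret prob_space M by fact
  let ?X = "\<lambda>\<omega>. \<lambda>i\<in>{1..N}. S i \<omega>" and ?Y = "\<lambda>\<omega>. \<lambda>i\<in>{1..N}. T i \<omega>"
  \<comment> \<open>Coordinates outside the given index set are left free by using
    \<open>UNIV\<close> there.\<close>
  let ?box = "\<lambda>V P. Pi\<^sub>E {1..N} (\<lambda>j. if j \<in> V then P j else (UNIV :: real set))"
  have indep: "indep_var (Pi\<^sub>M {1..N} (\<lambda>_. borel)) ?X (Pi\<^sub>M {1..N} (\<lambda>_. borel)) ?Y"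
    using assms(2) by (simp add: indep_families_def)
  have box: "?box V P \<in> sets (Pi\<^sub>M {1..N} (\<lambda>_. borel))"
      "?box W Q \<in> sets (Pi\<^sub>M {1..N} (\<lambda>_. borel))"
    using P Q by (auto intro!: sets_PiM_I_finite)
  have X: "?X -` ?box V P \<inter> space M = {\<omega>\<in>space M. \<forall>j\<in>V. S j \<omega> \<in> P j}"
    using V by (auto simp: PiE_iff split: if_splits)
  have Y: "?Y -` ?box W Q \<inter> space M = {\<omega>\<in>space M. \<forall>j\<in>W. T j \<omega> \<in> Q j}"
    using W by (auto simp: PiE_iff split: if_splits)
  have XY: "(\<lambda>\<omega>. (?X \<omega>, ?Y \<omega>)) -` (?box V P \<times> ?box W Q) \<inter> space M =
      (?X -` ?box V P \<inter> space M) \<inter> (?Y -` ?box W Q \<inter> space M)"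
    by auto
  have "{\<omega>\<in>space M. (\<forall>j\<in>V. S j \<omega> \<in> P j) \<and> (\<forall>j\<in>W. T j \<omega> \<in> Q j)} =
      {\<omega>\<in>space M. \<forall>j\<in>V. S j \<omega> \<in> P j} \<inter> {\<omega>\<in>space M. \<forall>j\<in>W. T j \<omega> \<in> Q j}"
    by auto
  then show ?thesis
    using indep_varD[OF indep box] unfolding XY X Y by simp
qed

lemma zero_one_rvs_mult:
  assumes "zero_one_rvs M N S" and "zero_one_rvs M N T"
  shows "zero_one_rvs M N (\<lambda>i \<omega>. S i \<omega> * T i \<omega>)"
  using assms unfolding zero_one_rvs_def by fastforce

text \<open>A product of zero-one values is 1 exactly when both factors are, so the event is a
  conjunction to which independence applies directly. The value 0 allows no such splitting. For
  singletons \<open>u\<close> this yields the marginals of the products.\<close>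

lemma indep_families_prob_mult_eq_1:
  assumes "prob_space M" and "indep_families M N S T"
    and S: "zero_one_rvs M N S" and T: "zero_one_rvs M N T" and u: "u \<subseteq> {1..N}"
  shows "measure M {\<omega>\<in>space M. \<forall>j\<in>u. S j \<omega> * T j \<omega> = 1} =
    measure M {\<omega>\<in>space M. \<forall>j\<in>u. S j \<omega> = 1} * measure M {\<omega>\<in>space M. \<forall>j\<in>u. T j \<omega> = 1}"
proof -
  have "S j \<omega> * T j \<omega> = 1 \<longleftrightarrow> S j \<omega> = 1 \<and> T j \<omega> = 1" if "\<omega> \<in> space M" "j \<in> u" for j \<omega>
    using S T u that unfolding zero_one_rvs_def by fastforce
  then have "{\<omega>\<in>space M. \<forall>j\<in>u. S j \<omega> * T j \<omega> = 1} =
      {\<omega>\<in>space M. (\<forall>j\<in>u. S j \<omega> \<in> {1}) \<and> (\<forall>j\<in>u. T j \<omega> \<in> {1})}"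
    by auto
  then show ?thesis
    using indep_families_prob[OF assms(1,2) u u, of "\<lambda>_. {1}" "\<lambda>_. {1}"] by simp
qed

lemma zero_one_rvs_prob_eq_0:
  assumes "prob_space M" and T: "zero_one_rvs M N T" and j: "j \<in> {1..N}"
  shows "measure M {\<omega>\<in>space M. T j \<omega> = 0} = 1 - measure M {\<omega>\<in>space M. T j \<omega> = 1}"
proof -
  interpret prob_space M by fact
  have [measurable]: "T j \<in> borel_measurable M"
    using T j by (simp add: zero_one_rvs_def)
  have "{\<omega>\<in>space M. T j \<omega> = 0} = space M - {\<omega>\<in>space M. T j \<omega> = 1}"
    using T j by (fastforce simp: zero_one_rvs_def)
  then show ?thesis
    by (simp add: prob_compl)
qed

lemma upper_neg_dep_mult:
  assumes M: "prob_space M"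
    and S: "upper_neg_dep M N \<alpha> S" and T: "upper_neg_dep M N \<beta> T"
    and ind: "indep_families M N S T"
  shows "upper_neg_dep M N (\<alpha> * \<beta>) (\<lambda>i \<omega>. S i \<omega> * T i \<omega>)"
proof -
  have zS: "zero_one_rvs M N S" and zT: "zero_one_rvs M N T" and ge: "1 \<le> \<alpha>" "1 \<le> \<beta>"
    using S T by (auto simp: upper_neg_dep_def)
  note mult = indep_families_prob_mult_eq_1[OF M ind zS zT]
  have "measure M {\<omega>\<in>space M. \<forall>j\<in>u. S j \<omega> * T j \<omega> = 1}
      \<le> \<alpha> * \<beta> * (\<Prod>j\<in>u. measure M {\<omega>\<in>space M. S j \<omega> * T j \<omega> = 1})"
    if u: "u \<subseteq> {1..N}" for u
  proof -
    have "measure M {\<omega>\<in>space M. \<forall>j\<in>u. S j \<omega> * T j \<omega> = 1} =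
        measure M {\<omega>\<in>space M. \<forall>j\<in>u. S j \<omega> = 1} * measure M {\<omega>\<in>space M. \<forall>j\<in>u. T j \<omega> = 1}"
      by (rule mult[OF u])
    also have "\<dots> \<le> (\<alpha> * (\<Prod>j\<in>u. measure M {\<omega>\<in>space M. S j \<omega> = 1})) *
        (\<beta> * (\<Prod>j\<in>u. measure M {\<omega>\<in>space M. T j \<omega> = 1}))"
      using S T u ge by (intro mult_mono)
        (auto simp: upper_neg_dep_def intro!: mult_nonneg_nonneg prod_nonneg)
    also have "\<dots> = \<alpha> * \<beta> *
        (\<Prod>j\<in>u. measure M {\<omega>\<in>space M. S j \<omega> = 1} * measure M {\<omega>\<in>space M. T j \<omega> = 1})"
      by (simp add: prod.distrib)
    also have "(\<Prod>j\<in>u. measure M {\<omega>\<in>space M. S j \<omega> = 1} * measure M {\<omega>\<in>space M. T j \<omega> = 1}) =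
        (\<Prod>j\<in>u. measure M {\<omega>\<in>space M. S j \<omega> * T j \<omega> = 1})"
      \<comment> \<open>The same factorization, now at single indices, recombines the
        marginals.\<close>
      using u mult[of "{j}" for j] by (intro prod.cong) auto
    finally show ?thesis .
  qed
  moreover have "1 \<le> \<alpha> * \<beta>"
    using mult_mono[of 1 \<alpha> 1 \<beta>] ge by simp
  ultimately show ?thesis
    using zero_one_rvs_mult[OF zS zT] by (simp add: upper_neg_dep_def)
qed

text \<open>The integrand is a multilinear polynomial in the indicators of \<open>T j = 0\<close>.
  Its coefficients are nonnegative, so the dependence bound may be applied monomial by monomial. The
  later use has \<open>c j = 1 - a j\<close>.\<close>

lemma lower_neg_dep_expectation_prod_le:
  assumes "prob_space M" and T: "lower_neg_dep M N \<beta> T" and u: "u \<subseteq> {1..N}"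
    and a: "\<And>j. j \<in> u \<Longrightarrow> 0 \<le> a j" "\<And>j. j \<in> u \<Longrightarrow> 0 \<le> c j"
  shows "(\<integral>\<omega>. (\<Prod>j\<in>u. a j * indicator {\<omega>. T j \<omega> = 0} \<omega> + c j) \<partial>M)
    \<le> \<beta> * (\<Prod>j\<in>u. a j * measure M {\<omega>\<in>space M. T j \<omega> = 0} + c j)"
proof -
  interpret prob_space M by fact
  have fu: "finite u" using u finite_subset by blast
  have meas: "T j \<in> borel_measurable M" if "j \<in> u" for j
    using T u that by (auto simp: lower_neg_dep_def zero_one_rvs_def)
  let ?Z = "\<lambda>w. {\<omega>\<in>space M. \<forall>j\<in>w. T j \<omega> = 0}"
  let ?k = "\<lambda>w. (\<Prod>j\<in>w. a j) * (\<Prod>j\<in>u - w. c j)"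
  \<comment> \<open>Kept general in \<open>g\<close>: it expands the product of indicators, and at
    the end folds the same sum back with probabilities in their place.\<close>
  have expand: "(\<Prod>j\<in>u. a j * g j + c j) = (\<Sum>w\<in>Pow u. ?k w * (\<Prod>j\<in>w. g j))" for g
    unfolding prod_add[OF fu] by (intro sum.cong refl) (simp add: prod.distrib)
  have Z: "?Z w \<in> sets M" if "w \<subseteq> u" for w
    using that fu meas by (intro sets.sets_Collect_finite_All) (auto intro: finite_subset)
  have "(\<Prod>j\<in>u. a j * indicator {\<omega>. T j \<omega> = 0} \<omega> + c j) =
      (\<Sum>w\<in>Pow u. ?k w * indicator (?Z w) \<omega>)" if "\<omega> \<in> space M" for \<omega>
  proof -
    have "(\<Prod>j\<in>w. indicator {\<omega>. T j \<omega> = 0} \<omega>) = (indicator (?Z w) \<omega> :: real)"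
      if "w \<subseteq> u" for w
      \<comment> \<open>The base case holds because \<open>?Z {}\<close> is all of
        \<open>space M\<close>, which contains \<omega>.\<close>
      using finite_subset[OF that fu] \<open>\<omega> \<in> space M\<close>
      by (induction w rule: finite_induct) (auto simp: indicator_def)
    then show ?thesis
      unfolding expand by (intro sum.cong refl) simp
  qed
  then have "(\<integral>\<omega>. (\<Prod>j\<in>u. a j * indicator {\<omega>. T j \<omega> = 0} \<omega> + c j) \<partial>M) =
      (\<integral>\<omega>. (\<Sum>w\<in>Pow u. ?k w * indicator (?Z w) \<omega>) \<partial>M)"
    by (intro Bochner_Integration.integral_cong) auto
  also have "\<dots> = (\<Sum>w\<in>Pow u. ?k w * measure M (?Z w))"
  proof (subst Bochner_Integration.integral_sum)
    show "integrable M (\<lambda>\<omega>. ?k w * indicator (?Z w) \<omega>)" if "w \<in> Pow u" for w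
      using Z that by (intro integrable_mult_right integrable_real_indicator)
        (auto simp: emeasure_eq_measure)
    show "(\<Sum>w\<in>Pow u. \<integral>\<omega>. ?k w * indicator (?Z w) \<omega> \<partial>M) = (\<Sum>w\<in>Pow u. ?k w * measure M (?Z w))"
      using Z by (intro sum.cong) auto
  qed
  also have "\<dots> \<le> (\<Sum>w\<in>Pow u. ?k w * (\<beta> * (\<Prod>j\<in>w. measure M {\<omega>\<in>space M. T j \<omega> = 0})))"
    using T u a by (intro sum_mono mult_left_mono)
      (auto simp: lower_neg_dep_def intro!: mult_nonneg_nonneg prod_nonneg)
  also have "\<dots> = \<beta> * (\<Prod>j\<in>u. a j * measure M {\<omega>\<in>space M. T j \<omega> = 0} + c j)"
    unfolding expand sum_distrib_left by (intro sum.cong refl) (simp only: mult_ac)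
  finally show ?thesis .
qed

lemma lower_neg_dep_mult:
  assumes M: "prob_space M"
    and S: "lower_neg_dep M N \<alpha> S" and T: "lower_neg_dep M N \<beta> T"
    and ind: "indep_families M N S T"
  shows "lower_neg_dep M N (\<alpha> * \<beta>) (\<lambda>i \<omega>. S i \<omega> * T i \<omega>)"
proof -
  interpret prob_space M by fact
  have zS: "zero_one_rvs M N S" and zT: "zero_one_rvs M N T" and ge: "1 \<le> \<alpha>" "1 \<le> \<beta>"
    using S T by (auto simp: lower_neg_dep_def)
  have "measure M {\<omega>\<in>space M. \<forall>j\<in>u. S j \<omega> * T j \<omega> = 0}
      \<le> \<alpha> * \<beta> * (\<Prod>j\<in>u. measure M {\<omega>\<in>space M. S j \<omega> * T j \<omega> = 0})"
    if u: "u \<subseteq> {1..N}" for u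
  proof -
    have fu: "finite u" using u finite_subset by blast
    define a where "a j = measure M {\<omega>\<in>space M. S j \<omega> = 1}" for j
    \<comment> \<open>\<open>D V\<close> says that the indices in \<open>u\<close> with
      \<open>T j = 1\<close> are exactly those in \<open>V\<close>; over V \<subseteq> u these
      events partition the space. \<open>C V\<close> is what remains to be required of
      \<open>S\<close> on that piece.\<close>
    define C where "C V = {\<omega>\<in>space M. \<forall>j\<in>V. S j \<omega> = 0}" for V
    define D where "D V = {\<omega>\<in>space M. \<forall>j\<in>u. T j \<omega> = indicator V j}" for V
    have measS: "S j \<in> borel_measurable M" and measT: "T j \<in> borel_measurable M" if "j \<in> u" for j
      using zS zT u that by (auto simp: zero_one_rvs_def)
    have C: "C V \<in> sets M" if "V \<subseteq> u" for V
      unfolding C_def using that fu measS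
      by (intro sets.sets_Collect_finite_All) (auto intro: finite_subset)
    have D: "D V \<in> sets M" for V
      unfolding D_def using fu measT by (intro sets.sets_Collect_finite_All) auto
    have T01: "T j \<omega> = 0 \<or> T j \<omega> = 1" if "\<omega> \<in> space M" "j \<in> u" for j \<omega>
      using zT u that by (auto simp: zero_one_rvs_def)
    \<comment> \<open>Each outcome determines its \<open>V\<close>. This gives disjointness here and
      later collapses a sum over \<open>Pow u\<close> to one term.\<close>
    have D_iff: "\<omega> \<in> D V \<longleftrightarrow> V = {j\<in>u. T j \<omega> = 1}" if "\<omega> \<in> space M" "V \<subseteq> u" for V \<omega>
    proof -
      have "T j \<omega> = indicator V j \<longleftrightarrow> (j \<in> V \<longleftrightarrow> T j \<omega> = 1)" if "j \<in> u" for j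
        using T01[OF \<open>\<omega> \<in> space M\<close> that] by (auto simp: indicator_def)
      then show ?thesis
        using that by (auto simp: D_def)
    qed
    have D_space: "D V \<subseteq> space M" for V
      by (auto simp: D_def)
    have disj: "disjoint_family_on (\<lambda>V. C V \<inter> D V) (Pow u)"
      unfolding disjoint_family_on_def
    proof (intro ballI impI)
      fix V W assume "V \<in> Pow u" "W \<in> Pow u" "V \<noteq> W"
      moreover have "V = W" if "\<omega> \<in> D V" "\<omega> \<in> D W" "V \<subseteq> u" "W \<subseteq> u" for \<omega>
      proof -
        have "\<omega> \<in> space M" using that(1) D_space by blast
        then show ?thesis
          using D_iff[of \<omega> V] D_iff[of \<omega> W] that by simp
      qed
      ultimately show "C V \<inter> D V \<inter> (C W \<inter> D W) = {}" by blast
    qed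
    \<comment> \<open>On \<open>D V\<close> the products at indices outside \<open>V\<close> vanish
      because \<open>T\<close> does, while those in \<open>V\<close> equal \<open>S j\<close> and
      vanish exactly on \<open>C V\<close>.\<close>
    have "{\<omega>\<in>space M. \<forall>j\<in>u. S j \<omega> * T j \<omega> = 0} = (\<Union>V\<in>Pow u. C V \<inter> D V)" (is "?E = ?U")
    proof
      show "?E \<subseteq> ?U"
      proof
        fix \<omega> assume "\<omega> \<in> ?E"
        then have \<omega>: "\<omega> \<in> space M" and ST: "\<And>j. j \<in> u \<Longrightarrow> S j \<omega> * T j \<omega> = 0" by auto
        have "\<omega> \<in> C {j\<in>u. T j \<omega> = 1}"
          unfolding C_def using \<omega> ST by fastforce
        moreover have "\<omega> \<in> D {j\<in>u. T j \<omega> = 1}"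
          by (subst D_iff[OF \<omega>]) auto
        ultimately show "\<omega> \<in> ?U"
          by (intro UN_I[of "{j\<in>u. T j \<omega> = 1}"] IntI) auto
      qed
      show "?U \<subseteq> ?E"
      proof
        fix \<omega> assume "\<omega> \<in> ?U"
        then obtain V where "V \<subseteq> u" "\<omega> \<in> C V" "\<omega> \<in> D V" by blast
        then have "S j \<omega> * T j \<omega> = 0" if "j \<in> u" for j
          using that by (cases "j \<in> V") (simp_all add: C_def D_def)
        then show "\<omega> \<in> ?E"
          using \<open>\<omega> \<in> C V\<close> by (simp add: C_def)
      qed
    qed
    then have "measure M {\<omega>\<in>space M. \<forall>j\<in>u. S j \<omega> * T j \<omega> = 0} =
        measure M (\<Union>V\<in>Pow u. C V \<inter> D V)"
      by simp
    also have "\<dots> = (\<Sum>V\<in>Pow u. measure M (C V \<inter> D V))"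
      using fu C D disj
      by (intro finite_measure_finite_Union) auto
    also have "\<dots> = (\<Sum>V\<in>Pow u. measure M (C V) * measure M (D V))"
    proof (rule sum.cong)
      fix V assume "V \<in> Pow u"
      then have V: "V \<subseteq> {1..N}" using u by auto
      have "C V \<inter> D V = {\<omega>\<in>space M. (\<forall>j\<in>V. S j \<omega> \<in> {0}) \<and> (\<forall>j\<in>u. T j \<omega> \<in> {indicator V j})}"
        by (auto simp: C_def D_def)
      then show "measure M (C V \<inter> D V) = measure M (C V) * measure M (D V)"
        using indep_families_prob[OF M ind V u, of "\<lambda>_. {0}" "\<lambda>j. {indicator V j}"]
        by (simp add: C_def D_def)
    qed simp
    also have "\<dots> \<le> (\<Sum>V\<in>Pow u. \<alpha> * (\<Prod>j\<in>V. 1 - a j) * measure M (D V))"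
    proof (intro sum_mono mult_right_mono)
      fix V assume "V \<in> Pow u"
      then have V: "V \<subseteq> {1..N}" using u by auto
      then have "measure M (C V) \<le> \<alpha> * (\<Prod>j\<in>V. measure M {\<omega>\<in>space M. S j \<omega> = 0})"
        using S by (simp add: lower_neg_dep_def C_def)
      also have "(\<Prod>j\<in>V. measure M {\<omega>\<in>space M. S j \<omega> = 0}) = (\<Prod>j\<in>V. 1 - a j)"
        using V zero_one_rvs_prob_eq_0[OF M zS] by (intro prod.cong) (auto simp: a_def)
      finally show "measure M (C V) \<le> \<alpha> * (\<Prod>j\<in>V. 1 - a j)" .
    qed simp
    also have "\<dots> = \<alpha> * (\<Sum>V\<in>Pow u. (\<Prod>j\<in>V. 1 - a j) * measure M (D V))"
      by (simp add: sum_distrib_left mult_ac)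
    \<comment> \<open>The sum is the expectation of the product of \<open>1 - a j\<close> over the
      random set of indices with \<open>T j = 1\<close>.\<close>
    also have "(\<Sum>V\<in>Pow u. (\<Prod>j\<in>V. 1 - a j) * measure M (D V)) =
        (\<integral>\<omega>. (\<Sum>V\<in>Pow u. (\<Prod>j\<in>V. 1 - a j) * indicator (D V) \<omega>) \<partial>M)"
    proof (subst Bochner_Integration.integral_sum)
      show "integrable M (\<lambda>\<omega>. (\<Prod>j\<in>V. 1 - a j) * indicator (D V) \<omega>)" for V
        using D by (intro integrable_mult_right integrable_real_indicator)
          (auto simp: emeasure_eq_measure)
    qed (use D in simp)
    also have "\<dots> = (\<integral>\<omega>. (\<Prod>j\<in>u. a j * indicator {\<omega>. T j \<omega> = 0} \<omega> + (1 - a j)) \<partial>M)"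
    proof (intro Bochner_Integration.integral_cong refl)
      fix \<omega> assume \<omega>: "\<omega> \<in> space M"
      let ?V = "{j\<in>u. T j \<omega> = 1}"
      have "(\<Sum>V\<in>Pow u. (\<Prod>j\<in>V. 1 - a j) * indicator (D V) \<omega>) =
          (\<Sum>V\<in>Pow u. if V = ?V then \<Prod>j\<in>?V. 1 - a j else 0)"
        using D_iff[OF \<omega>] by (intro sum.cong) (simp_all add: indicator_def)
      also have "\<dots> = (\<Prod>j\<in>?V. 1 - a j)"
        using fu by (subst sum.delta) auto
      also have "\<dots> = (\<Prod>j\<in>u. if T j \<omega> = 1 then 1 - a j else 1)"
        using fu by (simp add: prod.inter_filter)
      \<comment> \<open>Each factor is \<open>a j + (1 - a j) = 1\<close> if \<open>T j\<close> is
        0, and \<open>1 - a j\<close> if it is 1.\<close>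
      also have "\<dots> = (\<Prod>j\<in>u. a j * indicator {\<omega>. T j \<omega> = 0} \<omega> + (1 - a j))"
        using T01[OF \<omega>] by (intro prod.cong) (auto simp: indicator_def)
      finally show "(\<Sum>V\<in>Pow u. (\<Prod>j\<in>V. 1 - a j) * indicator (D V) \<omega>) =
          (\<Prod>j\<in>u. a j * indicator {\<omega>. T j \<omega> = 0} \<omega> + (1 - a j))" .
    qed
    also have "\<alpha> * \<dots> \<le>
        \<alpha> * (\<beta> * (\<Prod>j\<in>u. a j * measure M {\<omega>\<in>space M. T j \<omega> = 0} + (1 - a j)))"
      using ge by (intro mult_left_mono lower_neg_dep_expectation_prod_le[OF M T u])
        (auto simp: a_def)
    \<comment> \<open>With b the probability of \<open>T j = 1\<close>, the factor is a(1 - b) + (1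
      - a) = 1 - ab, and ab is the probability that the product is 1.\<close>
    also have "(\<Prod>j\<in>u. a j * measure M {\<omega>\<in>space M. T j \<omega> = 0} + (1 - a j)) =
        (\<Prod>j\<in>u. measure M {\<omega>\<in>space M. S j \<omega> * T j \<omega> = 0})"
    proof (intro prod.cong refl)
      fix j assume "j \<in> u"
      then have j: "j \<in> {1..N}" using u by auto
      then show "a j * measure M {\<omega>\<in>space M. T j \<omega> = 0} + (1 - a j) =
          measure M {\<omega>\<in>space M. S j \<omega> * T j \<omega> = 0}"
        using indep_families_prob_mult_eq_1[OF M ind zS zT, of "{j}"]
        unfolding a_def zero_one_rvs_prob_eq_0[OF M zT j]
          zero_one_rvs_prob_eq_0[OF M zero_one_rvs_mult[OF zS zT] j]
        by (simp add: right_diff_distrib)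
    qed
    finally show ?thesis
      by (simp add: mult.assoc)
  qed
  moreover have "1 \<le> \<alpha> * \<beta>"
    using mult_mono[of 1 \<alpha> 1 \<beta>] ge by simp
  ultimately show ?thesis
    using zero_one_rvs_mult[OF zS zT] by (simp add: lower_neg_dep_def)
qed

theorem proposition4p10:
  fixes M :: "'w measure" and N :: nat
    and A :: "(real^'m) set" and B :: "(real^'n) set"
    and x :: "nat \<Rightarrow> 'w \<Rightarrow> real^'m" and y :: "nat \<Rightarrow> 'w \<Rightarrow> real^'n"
    and \<alpha> \<beta> :: real
  assumes "prob_space M"
    and "A \<in> sets borel" and "A \<subseteq> unit_cube"
    and "B \<in> sets borel" and "B \<subseteq> unit_cube"
    and "sampling_scheme M N x" and "sampling_scheme M N y"
    and "\<alpha> \<ge> 1" and "\<beta> \<ge> 1"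
  shows
    "(upper_neg_dep M N \<alpha> (\<lambda>i \<omega>. indicator A (x i \<omega>)) \<and>
      upper_neg_dep M N \<beta> (\<lambda>i \<omega>. indicator B (y i \<omega>)) \<and>
      indep_families M N (\<lambda>i \<omega>. indicator A (x i \<omega>)) (\<lambda>i \<omega>. indicator B (y i \<omega>))
      \<longrightarrow> upper_neg_dep M N (\<alpha> * \<beta>) (\<lambda>i \<omega>. indicator (A \<times> B) (x i \<omega>, y i \<omega>))) \<and>
     (lower_neg_dep M N \<alpha> (\<lambda>i \<omega>. indicator A (x i \<omega>)) \<and>
      lower_neg_dep M N \<beta> (\<lambda>i \<omega>. indicator B (y i \<omega>)) \<and>
      indep_families M N (\<lambda>i \<omega>. indicator A (x i \<omega>)) (\<lambda>i \<omega>. indicator B (y i \<omega>))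
      \<longrightarrow> lower_neg_dep M N (\<alpha> * \<beta>) (\<lambda>i \<omega>. indicator (A \<times> B) (x i \<omega>, y i \<omega>)))"
  using upper_neg_dep_mult[OF assms(1)] lower_neg_dep_mult[OF assms(1)]
  \<comment> \<open>The indicator of \<open>A \<times> B\<close> is the product of the two
    indicators, which reduces both claims to products of zero-one variables.\<close>
  unfolding indicator_times fst_conv snd_conv by blast

end
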